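(* Let $m,n\geq 0$ be integers. The kernel $K_{m,n}$ of the composition $M_m\circ M_n$ of the classical Bernstein--Durrmeyer operators has, for $x,y\in[0,1]$, the representation $$K_{m,n}(x,y)=\frac{(m+1)!\,(n+1)!}{(m+n+1)!}\sum_{k=0}^{\min\{m,n\}}\binom{m}{k}\binom{n}{k}\sum_{\ell=0}^{k}p_{k,\ell}(x)\,p_{k,\ell}(y).$$
   Context: For integers $n\ge 0$ and $0\le k\le n$, let $p_{n,k}(x)=\binom{n}{k}x^k(1-x)^{n-k}$. The Bernstein--Durrmeyer operator $M_n$ maps $f\in L_1[0,1]$ to the polynomial $$(M_nf)(x)=\int_0^1 f(y)K_n(x,y)\,dy,\quad x\in[0,1],\qquad K_n(x,y)=(n+1)\sum_{k=0}^n p_{n,k}(x)p_{n,k}(y).$$ The kernel of the composition $M_m\circ M_n$ is $$K_{m,n}(x,y)=\int_0^1 K_n(t,y)\,K_m(x,t)\,dt,$$ so that $((M_m\circ M_n)f)(x)=\int_0^1 f(y)K_{m,n}(x,y)\,dy$ for $f\in L_1[0,1]$. *)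

theory Defs
  imports "HOL-Analysis.Analysis"
begin

text \<open>
  The polynomial \<open>p\<^sub>n\<^sub>,\<^sub>k\<close> is the library's \<^term>\<open>Bernstein n k\<close>. Integrals over \<open>[0,1]\<close> are
  Lebesgue integrals, so that the operators make sense on all of \<open>L\<^sub>1[0,1]\<close>.
\<close>

definition durrmeyer_kernel :: "nat \<Rightarrow> real \<Rightarrow> real \<Rightarrow> real" where
  "durrmeyer_kernel n x y = (real n + 1) * (\<Sum>k=0..n. Bernstein n k x * Bernstein n k y)"

definition durrmeyer :: "nat \<Rightarrow> (real \<Rightarrow> real) \<Rightarrow> real \<Rightarrow> real" where
  "durrmeyer n f x = (LINT y:{0..1}|lebesgue. f y * durrmeyer_kernel n x y)"

definition durrmeyer_comp_kernel :: "nat \<Rightarrow> nat \<Rightarrow> real \<Rightarrow> real \<Rightarrow> real" where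
  "durrmeyer_comp_kernel m n x y =
     (LINT t:{0..1}|lebesgue. durrmeyer_kernel n t y * durrmeyer_kernel m x t)"

lemma continuous_on_Bernstein: "continuous_on A (Bernstein n k)"
  unfolding Bernstein_def by (intro continuous_intros)

lemma set_integrable_mult_continuous:
  fixes f g :: "real \<Rightarrow> real"
  assumes f: "set_integrable lebesgue {0..1} f" and g: "continuous_on {0..1} g"
  shows "set_integrable lebesgue {0..1} (\<lambda>y. f y * g y)"
proof -
  have "(\<lambda>y. g y * f y) absolutely_integrable_on {0..1}"
  proof (rule absolutely_integrable_bounded_measurable_product_real)
    show "g \<in> borel_measurable (lebesgue_on {0..1})"
      using g by (intro continuous_imp_measurable_on_sets_lebesgue) auto
    show "bounded (g ` {0..1})"
      using g by (intro compact_imp_bounded compact_continuous_image) auto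
  qed (use f in auto)
  then show ?thesis by (simp add: mult.commute)
qed

lemma set_integrable_continuous_unit:
  fixes g :: "real \<Rightarrow> real"
  assumes "continuous_on {0..1} g"
  shows "set_integrable lebesgue {0..1} g"
  using absolutely_integrable_continuous[of 0 1 g] assms by simp

lemma set_integrable_sum_unit:
  fixes f :: "nat \<Rightarrow> real \<Rightarrow> real"
  assumes "\<And>k. set_integrable lebesgue {0..1} (f k)"
  shows "set_integrable lebesgue {0..1} (\<lambda>y. \<Sum>k=0..n. f k y)"
  using assms unfolding set_integrable_def
  by (simp only: scaleR_sum_right Bochner_Integration.integrable_sum)

lemma set_integral_sum_unit:
  fixes f :: "nat \<Rightarrow> real \<Rightarrow> real"
  assumes "\<And>k. set_integrable lebesgue {0..1} (f k)"
  shows "(LINT y:{0..1}|lebesgue. (\<Sum>k=0..n. f k y)) = (\<Sum>k=0..n. LINT y:{0..1}|lebesgue. f k y)"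
  using assms unfolding set_lebesgue_integral_def set_integrable_def
  by (simp only: scaleR_sum_right Bochner_Integration.integral_sum)

lemma durrmeyer_conv_sum:
  assumes f: "set_integrable lebesgue {0..1} f"
  shows "durrmeyer n f x =
    (\<Sum>k=0..n. (real n + 1) * Bernstein n k x * (LINT y:{0..1}|lebesgue. f y * Bernstein n k y))"
proof -
  have "durrmeyer n f x = (LINT y:{0..1}|lebesgue.
     (\<Sum>k=0..n. ((real n + 1) * Bernstein n k x) * (f y * Bernstein n k y)))"
    unfolding durrmeyer_def durrmeyer_kernel_def
    by (simp add: sum_distrib_left mult_ac)
  also have "\<dots> = (\<Sum>k=0..n. LINT y:{0..1}|lebesgue. ((real n + 1) * Bernstein n k x) * (f y * Bernstein n k y))"
    by (intro set_integral_sum_unit set_integrable_mult_right set_integrable_mult_continuous f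
        continuous_on_Bernstein)
  finally show ?thesis by simp
qed

lemma durrmeyer_comp_kernel_eq:
  "durrmeyer_comp_kernel m n x y = durrmeyer m (\<lambda>t. durrmeyer_kernel n t y) x"
  unfolding durrmeyer_comp_kernel_def durrmeyer_def by simp

lemma continuous_on_durrmeyer_kernel_left: "continuous_on A (\<lambda>t. durrmeyer_kernel n t y)"
  unfolding durrmeyer_kernel_def
  by (intro continuous_intros continuous_on_Bernstein)

lemma continuous_on_durrmeyer:
  assumes f: "set_integrable lebesgue {0..1} f"
  shows "continuous_on A (durrmeyer n f)"
  unfolding durrmeyer_conv_sum[OF f, abs_def]
  by (intro continuous_intros continuous_on_Bernstein)

text \<open>The function \<^const>\<open>durrmeyer_comp_kernel\<close> is indeed the kernel of the composition.\<close>

lemma durrmeyer_comp: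
  assumes f: "set_integrable lebesgue {0..1} f"
  shows "durrmeyer m (durrmeyer n f) x =
    (LINT y:{0..1}|lebesgue. f y * durrmeyer_comp_kernel m n x y)"
proof -
  let ?I = "\<lambda>g. LINT y:{0..1}|lebesgue. g y"
  let ?B = "\<lambda>k j. ?I (\<lambda>t. Bernstein n j t * Bernstein m k t)"
  let ?c = "real n + 1" and ?d = "real m + 1"
  have B: "set_integrable lebesgue {0..1} (\<lambda>t. Bernstein n j t * Bernstein m k t)" for k j
    by (intro set_integrable_continuous_unit continuous_intros continuous_on_Bernstein)
  have kk: "durrmeyer_comp_kernel m n x y =
    (\<Sum>k=0..m. \<Sum>j=0..n. ?d * Bernstein m k x * ?c * ?B k j * Bernstein n j y)" for y
  proof -
    have "?I (\<lambda>t. durrmeyer_kernel n t y * Bernstein m k t) =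
      (\<Sum>j=0..n. ?c * ?B k j * Bernstein n j y)" for k
    proof -
      have "?I (\<lambda>t. durrmeyer_kernel n t y * Bernstein m k t) =
        ?I (\<lambda>t. \<Sum>j=0..n. (?c * Bernstein n j y) * (Bernstein n j t * Bernstein m k t))"
        by (simp add: durrmeyer_kernel_def sum_distrib_left sum_distrib_right mult_ac)
      also have "\<dots> = (\<Sum>j=0..n. ?I (\<lambda>t. (?c * Bernstein n j y) * (Bernstein n j t * Bernstein m k t)))"
        by (intro set_integral_sum_unit set_integrable_mult_right B)
      also have "\<dots> = (\<Sum>j=0..n. (?c * Bernstein n j y) * ?B k j)"
        by (simp only: set_integral_mult_right)
      finally show ?thesis by (simp only: mult_ac)
    qed
    then show ?thesis
      by (simp add: durrmeyer_comp_kernel_eq sum_distrib_left mult_ac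
          durrmeyer_conv_sum[OF set_integrable_continuous_unit[OF continuous_on_durrmeyer_kernel_left]])
  qed
  have "?I (\<lambda>t. durrmeyer n f t * Bernstein m k t) =
      (\<Sum>j=0..n. ?c * ?B k j * ?I (\<lambda>y. f y * Bernstein n j y))" for k
  proof -
    have "?I (\<lambda>t. durrmeyer n f t * Bernstein m k t) =
      ?I (\<lambda>t. \<Sum>j=0..n. (?c * ?I (\<lambda>y. f y * Bernstein n j y)) * (Bernstein n j t * Bernstein m k t))"
      by (simp add: durrmeyer_conv_sum[OF f] sum_distrib_left sum_distrib_right mult_ac)
    also have "\<dots> = (\<Sum>j=0..n. ?I (\<lambda>t. (?c * ?I (\<lambda>y. f y * Bernstein n j y)) * (Bernstein n j t * Bernstein m k t)))"
      by (intro set_integral_sum_unit set_integrable_mult_right B)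
    also have "\<dots> = (\<Sum>j=0..n. (?c * ?I (\<lambda>y. f y * Bernstein n j y)) * ?B k j)"
        by (simp only: set_integral_mult_right)
      finally show ?thesis by (simp only: mult_ac)
  qed
  then have "durrmeyer m (durrmeyer n f) x =
    (\<Sum>k=0..m. \<Sum>j=0..n. ?d * Bernstein m k x * ?c * ?B k j * ?I (\<lambda>y. f y * Bernstein n j y))"
    by (simp add: durrmeyer_conv_sum[OF set_integrable_continuous_unit[OF continuous_on_durrmeyer[OF f]]]
        sum_distrib_left mult_ac)
  also have "\<dots> = (\<Sum>k=0..m. \<Sum>j=0..n.
      ?I (\<lambda>y. (?d * Bernstein m k x * ?c * ?B k j) * (f y * Bernstein n j y)))"
    by simp
  also have "\<dots> = (\<Sum>k=0..m. ?I (\<lambda>y. \<Sum>j=0..n.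
      (?d * Bernstein m k x * ?c * ?B k j) * (f y * Bernstein n j y)))"
    by (intro sum.cong refl set_integral_sum_unit[symmetric] set_integrable_mult_right
        set_integrable_mult_continuous f continuous_on_Bernstein)
  also have "\<dots> = ?I (\<lambda>y. \<Sum>k=0..m. \<Sum>j=0..n.
      (?d * Bernstein m k x * ?c * ?B k j) * (f y * Bernstein n j y))"
    by (intro set_integral_sum_unit[symmetric] set_integrable_sum_unit set_integrable_mult_right
        set_integrable_mult_continuous f continuous_on_Bernstein)
  also have "\<dots> = ?I (\<lambda>y. f y * durrmeyer_comp_kernel m n x y)"
    by (simp add: kk sum_distrib_left mult_ac)
  finally show ?thesis .
qed

end

theory Submission
  imports Defs
begin

text \<open>
  Both sides are combinations of the products \<open>p\<^sub>m\<^sub>,\<^sub>i(x) p\<^sub>n\<^sub>,\<^sub>j(y)\<close>, and the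
  identity already holds coefficient by coefficient.

  Write \<open>C(a, b)\<close> for the binomial coefficient. On the left, inserting the two kernels
  leaves the coefficient
  \<open>(m+1)(n+1) \<integral> p\<^sub>m\<^sub>,\<^sub>i p\<^sub>n\<^sub>,\<^sub>j\<close>. The integral is a Beta value, and its factorials regroup
  to the claimed prefactor times \<open>C(i+j, i) C(m+n-i-j, m-i)\<close>
  (lemma \<open>integral_Bernstein_mult\<close>).

  On the right, degree elevation writes \<open>C(m,k) p\<^sub>k\<^sub>,\<^sub>l\<close> in the basis of degree \<open>m\<close>
  with coefficients \<open>C(i,l) C(m-i,k-l)\<close> (lemma \<open>Bernstein_elevation\<close>), and
  likewise in the variable \<open>y\<close> with \<open>n\<close> and \<open>j\<close>. In the sum over \<open>k\<close> and \<open>l\<close> of the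
  products of these coefficients, the variables \<open>l\<close> and \<open>r = k - l\<close> separate, and
  Vandermonde's identity evaluates each of the two factors. The result is the same
  \<open>C(i+j, i) C(m+n-i-j, m-i)\<close> (lemma \<open>sum_connection_coeffs\<close>).
\<close>

lemma has_integral_power_mult_one_minus_power:
  "((\<lambda>t::real. t ^ a * (1 - t) ^ b) has_integral (fact a * fact b / fact (a + b + 1))) {0..1}"
proof -
  have "((\<lambda>t. t powr (real (a + 1) - 1) * (1 - t) powr (real (b + 1) - 1)) has_integral
      Beta (real (a + 1)) (real (b + 1))) {0..1}"
    by (rule has_integral_Beta_real) auto
  also have "Beta (real (a + 1)) (real (b + 1)) = fact a * fact b / fact (a + b + 1)"
    using Gamma_fact[of a, where 'a = real] Gamma_fact[of b, where 'a = real]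
      Gamma_fact[of "a + b + 1", where 'a = real]
    by (simp add: Beta_def add_ac)
  \<comment> \<open>At the endpoints \<open>0 powr 0 = 0\<close> but \<open>0 ^ 0 = 1\<close>.\<close>
  finally show ?thesis
    by (rule has_integral_spike_finite[of "{0, 1}", rotated 2]) (auto simp: powr_realpow)
qed

text \<open>
  Both sides equal \<open>(a+b+c+d)! / (a! b! c! d!)\<close>: the number of ways to fill a two-by-two
  table with cell sizes \<open>a, b, c, d\<close>, splitting first by columns or first by rows.
\<close>

lemma binomial_two_by_two_table:
  fixes a b c d :: nat
  shows "real ((a + b + c + d) choose (a + c)) * real ((a + c) choose a) * real ((b + d) choose b) =
    real ((a + b + c + d) choose (a + b)) * real ((a + b) choose a) * real ((c + d) choose c)"
  by (simp add: binomial_fact)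

text \<open>
  The trinomial-revision identity behind degree elevation. It is the table count with cells
  \<open>l, k - l, i - l, m - k - i + l\<close>; if the last one would be negative, both sides vanish.
\<close>

lemma Bernstein_elevation_coeff:
  assumes "i \<le> m" "k \<le> m" "l \<le> k" "l \<le> i"
  shows "real (m choose i) * (real (i choose l) * real ((m - i) choose (k - l))) =
    real (m choose k) * real (k choose l) * real ((m - k) choose (i - l))"
proof (cases "i + k \<le> m + l")
  case True
  define b c d where "b = k - l" and "c = i - l" and "d = m - (l + b + c)"
  have "m = l + b + c + d" "k = l + b" "i = l + c"
    using True assms by (auto simp: b_def c_def d_def)
  then show ?thesis
    using binomial_two_by_two_table[of l b c d] by (simp add: mult_ac)
next
  case False
  then have "m - i < k - l" "m - k < i - l" using assms by auto
  then show ?thesis by (simp add: binomial_eq_0)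
qed

text \<open>
  Multiplying \<open>p\<^sub>k\<^sub>,\<^sub>l(x)\<close> by \<open>1 = (x + (1 - x))^(m - k)\<close> and expanding gives monomials
  \<open>x^i (1 - x)^(m - i)\<close>. The factor \<open>m choose k\<close> is kept because with it the coefficients
  become products in which \<open>l\<close> and \<open>k - l\<close> are separated. In probabilistic terms, keeping a
  random \<open>k\<close>-subset of \<open>m\<close> Bernoulli trials leaves \<open>k\<close> Bernoulli trials.
\<close>

lemma Bernstein_elevation:
  assumes "l \<le> k" "k \<le> m"
  shows "real (m choose k) * Bernstein k l x =
    (\<Sum>i=0..m. real (i choose l) * real ((m - i) choose (k - l)) * Bernstein m i x)"
proof -
  let ?g = "\<lambda>i. real (i choose l) * real ((m - i) choose (k - l)) * Bernstein m i x"
  have "(1::real) = (\<Sum>s\<le>m - k. real ((m - k) choose s) * x ^ s * (1 - x) ^ (m - k - s))"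
    using binomial_ring[of x "1 - x" "m - k"] by simp
  then have "real (m choose k) * Bernstein k l x =
    (\<Sum>s\<le>m - k. real (m choose k) * Bernstein k l x *
      (real ((m - k) choose s) * x ^ s * (1 - x) ^ (m - k - s)))"
    by (simp only: sum_distrib_left[symmetric] mult_1_right)
  also have "\<dots> = (\<Sum>s\<le>m - k. ?g (s + l))"
  proof (rule sum.cong[OF refl])
    fix s assume "s \<in> {..m - k}"
    then have s: "s + l \<le> m" "k - l + (m - k - s) = m - (s + l)"
      using assms by auto
    have "real (m choose k) * Bernstein k l x *
        (real ((m - k) choose s) * x ^ s * (1 - x) ^ (m - k - s)) =
      real (m choose k) * real (k choose l) * real ((m - k) choose s) *
        x ^ (s + l) * (1 - x) ^ (k - l + (m - k - s))"
      by (simp add: Bernstein_def power_add mult_ac)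
    also have "\<dots> = ?g (s + l)"
      using Bernstein_elevation_coeff[of "s + l" m k l, symmetric] assms s
      by (simp only: Bernstein_def add_diff_cancel_right' le_add2 mult_ac)
    finally show "real (m choose k) * Bernstein k l x *
        (real ((m - k) choose s) * x ^ s * (1 - x) ^ (m - k - s)) = ?g (s + l)" .
  qed
  also have "\<dots> = (\<Sum>i=l..m - k + l. ?g i)"
    using sum.shift_bounds_cl_nat_ivl[of ?g 0 l "m - k"] by (simp add: atMost_atLeast0)
  also have "\<dots> = (\<Sum>i=0..m. ?g i)"
    \<comment> \<open>Terms with \<open>i < l\<close> or \<open>m - i < k - l\<close> vanish.\<close>
    using assms by (intro sum.mono_neutral_left) (auto simp: binomial_eq_0_iff)
  finally show ?thesis .
qed

text \<open>
  Vandermonde's identity after reflecting \<open>l\<close> in \<open>i choose l\<close>.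
\<close>

lemma sum_choose_mult_choose_same:
  "(\<Sum>l\<le>min i j. (i choose l) * (j choose l)) = (i + j) choose i"
proof -
  have "(\<Sum>l\<le>min i j. (i choose l) * (j choose l)) = (\<Sum>l\<le>i. (i choose l) * (j choose l))"
    by (rule sum.mono_neutral_left) (auto simp: binomial_eq_0_iff)
  also have "\<dots> = (\<Sum>l\<le>i. (j choose l) * (i choose (i - l)))"
    by (rule sum.cong) (auto simp: binomial_symmetric[symmetric])
  finally show ?thesis
    using vandermonde[of j i i] by (simp add: add.commute)
qed

text \<open>
  Along the diagonals \<open>l + r = k\<close> the sum runs over the triangle \<open>l + r \<le> min m n\<close>. The
  summand lives on the rectangle \<open>l \<le> min i j\<close>, \<open>r \<le> min (m - i) (n - j)\<close>, which lies inside
  this triangle, so the double sum factors.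
\<close>

lemma sum_connection_coeffs:
  assumes "i \<le> m" "j \<le> n"
  shows "(\<Sum>k\<le>min m n. \<Sum>l\<le>k.
      ((i choose l) * ((m - i) choose (k - l))) * ((j choose l) * ((n - j) choose (k - l)))) =
    ((i + j) choose i) * (((m - i) + (n - j)) choose (m - i))"
proof -
  let ?u = "\<lambda>l. (i choose l) * (j choose l)"
  let ?v = "\<lambda>r. ((m - i) choose r) * ((n - j) choose r)"
  have fin: "finite {(l, r). l + r \<le> min m n}"
    by (rule finite_subset[of _ "{..m} \<times> {..m}"]) auto
  have "(\<Sum>k\<le>min m n. \<Sum>l\<le>k.
      ((i choose l) * ((m - i) choose (k - l))) * ((j choose l) * ((n - j) choose (k - l)))) =
    (\<Sum>k\<le>min m n. \<Sum>l\<le>k. ?u l * ?v (k - l))"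
    by (simp add: mult_ac)
  also have "\<dots> = (\<Sum>(l, r) \<in> {(l, r). l + r \<le> min m n}. ?u l * ?v r)"
    by (rule sum.triangle_reindex_eq[symmetric])
  also have "\<dots> = (\<Sum>(l, r) \<in> {..min i j} \<times> {..min (m - i) (n - j)}. ?u l * ?v r)"
    using assms fin by (intro sum.mono_neutral_right) (auto simp: binomial_eq_0_iff min_def split: if_splits)
  also have "\<dots> = (\<Sum>l\<le>min i j. ?u l) * (\<Sum>r\<le>min (m - i) (n - j). ?v r)"
    by (simp add: sum_product sum.cartesian_product)
  finally show ?thesis by (simp only: sum_choose_mult_choose_same)
qed

text \<open>
  The Beta value contributes \<open>(i + j)! (m - i + n - j)! / (m + n + 1)!\<close>. The denominators of
  \<open>m choose i\<close> and \<open>n choose j\<close> turn its numerator into the two binomial coefficients of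
  \<open>sum_connection_coeffs\<close>, and their numerators \<open>m! n!\<close> absorb the factor \<open>(m + 1)(n + 1)\<close>.
\<close>

lemma integral_Bernstein_mult:
  assumes "i \<le> m" "j \<le> n"
  shows "(real m + 1) * (real n + 1) *
      (LINT t:{0..1}|lebesgue. Bernstein n j t * Bernstein m i t) =
    fact (m + 1) * fact (n + 1) / fact (m + n + 1) *
      (real ((i + j) choose i) * real (((m - i) + (n - j)) choose (m - i)))"
proof -
  obtain p q where mn: "m = i + p" "n = j + q"
    using assms by (metis le_add_diff_inverse)
  have eq: "Bernstein n j t * Bernstein m i t =
      real (m choose i) * real (n choose j) * (t ^ (i + j) * (1 - t) ^ (p + q))" for t
    by (simp add: Bernstein_def mn power_add mult_ac)
  have "(LINT t:{0..1}|lebesgue. Bernstein n j t * Bernstein m i t) =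
      integral {0..1} (\<lambda>t. Bernstein n j t * Bernstein m i t)"
    by (intro set_lebesgue_integral_eq_integral set_integrable_continuous_unit
        continuous_intros continuous_on_Bernstein)
  also have "\<dots> = real (m choose i) * real (n choose j) *
      (fact (i + j) * fact (p + q) / fact (i + j + (p + q) + 1))"
    unfolding eq
    by (intro integral_unique has_integral_mult_right has_integral_power_mult_one_minus_power)
  finally have "(LINT t:{0..1}|lebesgue. Bernstein n j t * Bernstein m i t) = \<dots>" .
  moreover have "real (m choose i) = fact m / (fact i * fact p)"
    "real (n choose j) = fact n / (fact j * fact q)"
    "real ((i + j) choose i) = fact (i + j) / (fact i * fact j)"
    "real (((m - i) + (n - j)) choose (m - i)) = fact (p + q) / (fact p * fact q)"
    by (simp_all add: binomial_fact mn)
  moreover have "fact (m + 1) = (real m + 1) * fact m" "fact (n + 1) = (real n + 1) * fact n"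
    by (simp_all add: algebra_simps)
  moreover have "i + j + (p + q) + 1 = m + n + 1"
    by (simp add: mn)
  ultimately show ?thesis
    by (simp only: times_divide_eq_left times_divide_eq_right divide_divide_eq_left mult_ac)
qed

text \<open>
  The kernel \<open>K\<^sub>n(t, y)\<close> is symmetric, so its integral against \<open>p\<^sub>m\<^sub>,\<^sub>i(t)\<close> is the operator
  \<open>M\<^sub>n\<close> applied to \<open>p\<^sub>m\<^sub>,\<^sub>i\<close>; the expansion of \<open>M\<^sub>n f\<close> in the Bernstein basis is thus
  used twice.
\<close>

lemma durrmeyer_comp_kernel_double_sum:
  "durrmeyer_comp_kernel m n x y =
    (\<Sum>i=0..m. \<Sum>j=0..n. ((real m + 1) * (real n + 1) *
      (LINT t:{0..1}|lebesgue. Bernstein n j t * Bernstein m i t)) *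
      (Bernstein m i x * Bernstein n j y))"
proof -
  have "(LINT t:{0..1}|lebesgue. durrmeyer_kernel n t y * Bernstein m i t) =
    (\<Sum>j=0..n. (real n + 1) * Bernstein n j y *
      (LINT t:{0..1}|lebesgue. Bernstein m i t * Bernstein n j t))" for i
  proof -
    have "(LINT t:{0..1}|lebesgue. durrmeyer_kernel n t y * Bernstein m i t) =
        durrmeyer n (Bernstein m i) y"
      by (simp add: durrmeyer_def durrmeyer_kernel_def mult_ac)
    then show ?thesis
      by (simp only: durrmeyer_conv_sum set_integrable_continuous_unit continuous_on_Bernstein)
  qed
  then show ?thesis
    by (simp add: durrmeyer_comp_kernel_eq sum_distrib_left mult_ac
        durrmeyer_conv_sum[OF set_integrable_continuous_unit[OF continuous_on_durrmeyer_kernel_left]])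
qed

lemma sum_Bernstein_elevation:
  "(\<Sum>k=0..min m n. real (m choose k) * real (n choose k) *
      (\<Sum>l=0..k. Bernstein k l x * Bernstein k l y)) =
    (\<Sum>i=0..m. \<Sum>j=0..n.
      (real ((i + j) choose i) * real (((m - i) + (n - j)) choose (m - i))) *
      (Bernstein m i x * Bernstein n j y))"
proof -
  define c where "c m k l i = (i choose l) * ((m - i) choose (k - l))" for m k l i :: nat
  have "(\<Sum>k=0..min m n. real (m choose k) * real (n choose k) *
      (\<Sum>l=0..k. Bernstein k l x * Bernstein k l y)) =
    (\<Sum>k=0..min m n. \<Sum>l=0..k.
      (real (m choose k) * Bernstein k l x) * (real (n choose k) * Bernstein k l y))"
    by (simp add: sum_distrib_left mult_ac)
  also have "\<dots> = (\<Sum>k=0..min m n. \<Sum>l=0..k. \<Sum>i=0..m. \<Sum>j=0..n.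
      real (c m k l i * c n k l j) * (Bernstein m i x * Bernstein n j y))"
    by (intro sum.cong refl) (simp add: Bernstein_elevation sum_product c_def mult_ac)
  also have "\<dots> = (\<Sum>k=0..min m n. \<Sum>i=0..m. \<Sum>j=0..n. \<Sum>l=0..k.
      real (c m k l i * c n k l j) * (Bernstein m i x * Bernstein n j y))"
    by (rule sum.cong[OF refl], subst sum.swap, rule sum.cong[OF refl], rule sum.swap)
  also have "\<dots> = (\<Sum>i=0..m. \<Sum>j=0..n. \<Sum>k=0..min m n. \<Sum>l=0..k.
      real (c m k l i * c n k l j) * (Bernstein m i x * Bernstein n j y))"
    by (subst sum.swap, rule sum.cong[OF refl], rule sum.swap)
  also have "\<dots> = (\<Sum>i=0..m. \<Sum>j=0..n.
      real (\<Sum>k\<le>min m n. \<Sum>l\<le>k. c m k l i * c n k l j) * (Bernstein m i x * Bernstein n j y))"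
    by (simp add: sum_distrib_right atMost_atLeast0)
  also have "\<dots> = (\<Sum>i=0..m. \<Sum>j=0..n.
      (real ((i + j) choose i) * real (((m - i) + (n - j)) choose (m - i))) *
      (Bernstein m i x * Bernstein n j y))"
    by (intro sum.cong refl) (simp only: c_def sum_connection_coeffs atLeastAtMost_iff of_nat_mult)
  finally show ?thesis .
qed

theorem theorem1:
  fixes m n :: nat and x y :: real
  assumes "x \<in> {0..1}" and "y \<in> {0..1}"
  shows "durrmeyer_comp_kernel m n x y =
    (fact (m + 1) * fact (n + 1) / fact (m + n + 1)) *
      (\<Sum>k=0..min m n. real (m choose k) * real (n choose k) *
        (\<Sum>l=0..k. Bernstein k l x * Bernstein k l y))"
  unfolding durrmeyer_comp_kernel_double_sum sum_Bernstein_elevation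
  unfolding sum_distrib_left
  by (intro sum.cong refl, subst integral_Bernstein_mult) (simp_all only: atLeastAtMost_iff mult.assoc)

end
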